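(* Let $K\ge1$ be an integer and let $p$ be an odd prime. If $q$ is a prime with $q\mid \pi_K(p)$, then $q\le p$, and equality $q=p$ can hold only if $p\mid K^2+4$.
   Context: The $K$-Fibonacci sequence is $F_{K,0}=0$, $F_{K,1}=1$, $F_{K,n}=K F_{K,n-1}+F_{K,n-2}$; for an integer $m>1$, $\pi_K(m)$ is the length of its shortest period modulo $m$. *)

theory Defs
  imports "HOL-Number_Theory.Number_Theory"
begin

fun kfib :: "nat \<Rightarrow> nat \<Rightarrow> nat" where
  "kfib K 0 = 0"
| "kfib K (Suc 0) = 1"
| "kfib K (Suc (Suc n)) = K * kfib K (Suc n) + kfib K n"

definition is_kfib_period :: "nat \<Rightarrow> nat \<Rightarrow> nat \<Rightarrow> bool" where
  "is_kfib_period K m t \<longleftrightarrow> 0 < t \<and> (\<forall>n. [kfib K (n + t) = kfib K n] (mod m))"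

definition kpisano :: "nat \<Rightarrow> nat \<Rightarrow> nat" where
  "kpisano K m = (LEAST t. is_kfib_period K m t)"

text \<open>The recurrence is invertible modulo \<open>m\<close>, so a period always exists and the
  \<open>LEAST\<close> in the definition of \<^const>\<open>kpisano\<close> is attained.\<close>

lemma is_kfib_period_exists:
  assumes "m > 0"
  shows "\<exists>t. is_kfib_period K m t"
proof -
  define f where "f i = (kfib K i mod m, kfib K (Suc i) mod m)" for i
  have "range f \<subseteq> {..<m} \<times> {..<m}"
    using assms by (auto simp: f_def)
  then have "finite (range f)"
    by (rule finite_subset) simp
  then have "\<not> inj f"
    using finite_imageD infinite_UNIV_nat by blast
  then obtain a b where "f a = f b" "a \<noteq> b"
    unfolding inj_def by blast
  then obtain i j where "f i = f j" "i < j"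
    by (metis linorder_neqE_nat)
  define t where "t = j - i"
  have t: "t > 0" "j = i + t"
    using \<open>i < j\<close> by (auto simp: t_def)
  have down: "f s = f (s + t) \<Longrightarrow> f 0 = f t" for s
  proof (induction s)
    case (Suc s)
    have a: "[kfib K (Suc s) = kfib K (Suc (s + t))] (mod m)"
      and b: "[kfib K (Suc (Suc s)) = kfib K (Suc (Suc (s + t)))] (mod m)"
      using Suc.prems unfolding f_def cong_def by simp_all
    have "[K * kfib K (Suc s) + kfib K (s + t) = K * kfib K (Suc (s + t)) + kfib K (s + t)] (mod m)"
      using a by (intro cong_add cong_mult cong_refl)
    then have "[K * kfib K (Suc s) + kfib K s = K * kfib K (Suc s) + kfib K (s + t)] (mod m)"
      using b by (metis cong_sym cong_trans kfib.simps(3))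
    then have "[kfib K s = kfib K (s + t)] (mod m)"
      by (simp add: cong_add_lcancel_nat)
    then have "f s = f (s + t)"
      using a by (simp add: f_def cong_def)
    then show ?case by (rule Suc.IH)
  qed simp
  have "f 0 = f t"
    using down[of i] \<open>f i = f j\<close> t by simp
  have "f (n + t) = f n" for n
  proof (induction n)
    case 0
    show ?case using \<open>f 0 = f t\<close> by simp
  next
    case (Suc n)
    then have "[kfib K (n + t) = kfib K n] (mod m)"
      and "[kfib K (Suc (n + t)) = kfib K (Suc n)] (mod m)"
      by (simp_all add: f_def cong_def)
    then have "[kfib K (Suc (Suc (n + t))) = kfib K (Suc (Suc n))] (mod m)"
      unfolding kfib.simps(3) by (intro cong_add cong_mult cong_refl)
    then show ?case
      using Suc by (simp add: f_def cong_def)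
  qed
  then show ?thesis
    using t unfolding is_kfib_period_def f_def cong_def by blast
qed

end

theory Submission
  imports Defs
begin

text \<open>Let \<open>D = K\<^sup>2 + 4\<close>. Binet's formula
  \<open>2\<^bsup>n\<^esup> F\<^bsub>n\<^esub> \<surd>D = (K + \<surd>D)\<^bsup>n\<^esup> - (K - \<surd>D)\<^bsup>n\<^esup>\<close> and its companion for
  \<open>L\<^bsub>n\<^esub> = 2 F\<^bsub>n+1\<^esub> - K F\<^bsub>n\<^esub>\<close> become identities between integers once the binomials are expanded.
  For \<open>n = p\<close> only the outer binomial coefficients survive modulo \<open>p\<close>, which leaves
  \<open>F\<^bsub>p\<^esub> \<equiv> D\<^bsup>(p-1)/2\<^esup> \<equiv> (D/p)\<close> and \<open>L\<^bsub>p\<^esub> \<equiv> K\<close>. According to the value \<open>1\<close>, \<open>-1\<close> or \<open>0\<close> of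
  the Legendre symbol, \<open>p\<close> divides \<open>F\<^bsub>t\<^esub>\<close> for \<open>t = p - 1\<close>, \<open>p + 1\<close> or \<open>p\<close>. A shift by such a \<open>t\<close>
  multiplies the sequence by \<open>F\<^bsub>t+1\<^esub>\<close>, whose order modulo \<open>p\<close> divides \<open>1\<close>, \<open>2\<close> or \<open>4\<close>
  respectively.\<close>

lemma is_kfib_period_diff:
  assumes "is_kfib_period K m s" "is_kfib_period K m t" "s < t"
  shows "is_kfib_period K m (t - s)"
  unfolding is_kfib_period_def
proof (intro conjI allI)
  fix n
  have "[kfib K (n + (t - s) + s) = kfib K (n + (t - s))] (mod m)"
    using assms(1) by (simp add: is_kfib_period_def)
  moreover have "[kfib K (n + t) = kfib K n] (mod m)"
    using assms(2) by (simp add: is_kfib_period_def)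
  moreover have "n + (t - s) + s = n + t"
    using assms(3) by simp
  ultimately show "[kfib K (n + (t - s)) = kfib K n] (mod m)"
    by (metis cong_sym cong_trans)
qed (use assms(3) in simp)

lemma kpisano_dvd_period:
  assumes "is_kfib_period K m t"
  shows "kpisano K m dvd t"
  using assms
proof (induction t rule: less_induct)
  case (less t)
  have period: "is_kfib_period K m (kpisano K m)"
    unfolding kpisano_def using less.prems by (rule LeastI)
  have "kpisano K m \<le> t"
    unfolding kpisano_def using less.prems by (rule Least_le)
  then consider "kpisano K m = t" | "kpisano K m < t"
    by linarith
  then show ?case
  proof cases
    case 2
    have "is_kfib_period K m (t - kpisano K m)"
      using period less.prems 2 by (rule is_kfib_period_diff)
    moreover have "t - kpisano K m < t"
      using period 2 by (simp add: is_kfib_period_def)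
    ultimately have "kpisano K m dvd t - kpisano K m"
      by (intro less.IH)
    then show ?thesis
      using 2 by (simp add: dvd_minus_self)
  qed simp
qed

lemma kfib_shift_cong:
  assumes "m dvd kfib K t"
  shows "[kfib K (n + t) = kfib K (Suc t) * kfib K n] (mod m)"
  using assms
proof (induction K n rule: kfib.induct)
  case (3 K n)
  then have "[K * kfib K (Suc n + t) + kfib K (n + t)
      = K * (kfib K (Suc t) * kfib K (Suc n)) + kfib K (Suc t) * kfib K n] (mod m)"
    by (intro cong_add cong_scalar_left)
  then show ?case
    by (simp add: algebra_simps)
qed (simp_all add: cong_0_iff)

lemma kfib_mult_shift_cong:
  assumes "m dvd kfib K t"
  shows "[kfib K (n + j * t) = kfib K (Suc t) ^ j * kfib K n] (mod m)"
proof (induction j)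
  case (Suc j)
  have "[kfib K (n + j * t + t) = kfib K (Suc t) * kfib K (n + j * t)] (mod m)"
    using assms by (rule kfib_shift_cong)
  also have "[kfib K (Suc t) * kfib K (n + j * t)
      = kfib K (Suc t) * (kfib K (Suc t) ^ j * kfib K n)] (mod m)"
    using Suc.IH by (rule cong_scalar_left)
  finally show ?case
    by (simp add: algebra_simps)
qed simp

lemma kpisano_dvd_mult:
  assumes "t > 0" "j > 0" "m dvd kfib K t" "[kfib K (Suc t) ^ j = 1] (mod m)"
  shows "kpisano K m dvd j * t"
proof -
  have "[kfib K (n + j * t) = kfib K n] (mod m)" for n
    using cong_trans[OF kfib_mult_shift_cong[OF assms(3)] cong_scalar_right[OF assms(4)]]
    by simp
  then have "is_kfib_period K m (j * t)"
    using assms(1,2) by (simp add: is_kfib_period_def)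
  then show ?thesis
    by (rule kpisano_dvd_period)
qed

definition binomial_transform :: "'a::comm_semiring_1 \<Rightarrow> (nat \<Rightarrow> 'a) \<Rightarrow> nat \<Rightarrow> 'a" where
  "binomial_transform a g n = (\<Sum>k\<le>n. of_nat (n choose k) * a ^ (n - k) * g k)"

lemma binomial_transform_0 [simp]: "binomial_transform a g 0 = g 0"
  by (simp add: binomial_transform_def)

lemma binomial_transform_mult_left:
  "binomial_transform a (\<lambda>k. c * g k) n = c * binomial_transform a g n"
  by (simp add: binomial_transform_def sum_distrib_left mult_ac)

lemma binomial_transform_Suc:
  "binomial_transform a g (Suc n)
    = a * binomial_transform a g n + binomial_transform a (\<lambda>k. g (Suc k)) n"
proof -
  let ?rest = "\<Sum>k\<le>n. of_nat (n choose Suc k) * a ^ (n - k) * g (Suc k)"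
  have "a * binomial_transform a g n
      = (\<Sum>k\<le>n. of_nat (n choose k) * a ^ (Suc n - k) * g k)"
    unfolding binomial_transform_def sum_distrib_left
    by (intro sum.cong) (simp_all add: Suc_diff_le mult_ac)
  also have "\<dots> = (\<Sum>k\<le>Suc n. of_nat (n choose k) * a ^ (Suc n - k) * g k)"
    by (simp add: binomial_eq_0)
  also have "\<dots> = a ^ Suc n * g 0 + ?rest"
    by (subst sum.atMost_Suc_shift) simp
  finally have "a * binomial_transform a g n = a ^ Suc n * g 0 + ?rest" .
  moreover have "binomial_transform a g (Suc n)
      = a ^ Suc n * g 0 + (binomial_transform a (\<lambda>k. g (Suc k)) n + ?rest)"
    unfolding binomial_transform_def
    by (subst sum.atMost_Suc_shift) (simp add: algebra_simps flip: sum.distrib)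
  ultimately show ?thesis
    by (simp add: ac_simps)
qed

lemma binomial_transform_prime_cong:
  fixes a :: "'a::unique_euclidean_semiring"
  assumes "prime p"
  shows "[binomial_transform a g p = a ^ p * g 0 + g p] (mod of_nat p)"
proof -
  let ?term = "\<lambda>k. of_nat (p choose k) * a ^ (p - k) * g k"
  have "{..p} = insert 0 (insert p {0<..<p})"
    using prime_gt_0_nat[OF assms] by auto
  then have "binomial_transform a g p = a ^ p * g 0 + g p + (\<Sum>k\<in>{0<..<p}. ?term k)"
    using prime_gt_0_nat[OF assms] by (simp add: binomial_transform_def add_ac)
  moreover have "of_nat p dvd (\<Sum>k\<in>{0<..<p}. ?term k)"
  proof (rule dvd_sum)
    fix k assume "k \<in> {0<..<p}"
    then have "p dvd (p choose k)"
      using assms by (intro dvd_choose_prime) auto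
    then have "of_nat p dvd (of_nat (p choose k) :: 'a)"
      by (auto elim!: dvdE)
    then show "of_nat p dvd ?term k"
      by simp
  qed
  ultimately show ?thesis
    using cong_add[OF cong_refl, of "\<Sum>k\<in>{0<..<p}. ?term k" 0] by (simp add: cong_0_iff)
qed

text \<open>With \<open>s\<^sup>2 = d\<close>, the power \<open>s\<^sup>k\<close> is
  \<open>sqrt_power_rational d k + sqrt_power_irrational d k * s\<close>.\<close>

definition sqrt_power_rational :: "'a::comm_semiring_1 \<Rightarrow> nat \<Rightarrow> 'a" where
  "sqrt_power_rational d k = (if even k then d ^ (k div 2) else 0)"

definition sqrt_power_irrational :: "'a::comm_semiring_1 \<Rightarrow> nat \<Rightarrow> 'a" where
  "sqrt_power_irrational d k = (if odd k then d ^ (k div 2) else 0)"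

lemma sqrt_power_0 [simp]:
  "sqrt_power_rational d 0 = 1" "sqrt_power_irrational d 0 = 0"
  by (simp_all add: sqrt_power_rational_def sqrt_power_irrational_def)

lemma sqrt_power_Suc [simp]:
  "sqrt_power_rational d (Suc k) = d * sqrt_power_irrational d k"
  "sqrt_power_irrational d (Suc k) = sqrt_power_rational d k"
  by (auto simp: sqrt_power_rational_def sqrt_power_irrational_def elim!: oddE)

definition kfib_discr :: "nat \<Rightarrow> int" where
  "kfib_discr K = (int K)\<^sup>2 + 4"

lemma dvd_kfib_discr_iff: "int p dvd kfib_discr K \<longleftrightarrow> p dvd K\<^sup>2 + 4"
proof -
  have "kfib_discr K = int (K\<^sup>2 + 4)"
    by (simp add: kfib_discr_def)
  then show ?thesis
    by (simp only: int_dvd_int_iff)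
qed

definition klucas :: "nat \<Rightarrow> nat \<Rightarrow> int" where
  "klucas K n = 2 * int (kfib K (Suc n)) - int K * int (kfib K n)"

lemma two_kfib_Suc: "2 * int (kfib K (Suc n)) = klucas K n + int K * int (kfib K n)"
  by (simp add: klucas_def)

lemma two_klucas_Suc:
  "2 * klucas K (Suc n) = int K * klucas K n + kfib_discr K * int (kfib K n)"
  by (simp add: klucas_def kfib_discr_def algebra_simps power2_eq_square)

lemma kfib_klucas_eq_binomial_transform:
  "2 ^ n * int (kfib K n)
    = 2 * binomial_transform (int K) (sqrt_power_irrational (kfib_discr K)) n"
  "2 ^ n * klucas K n
    = 2 * binomial_transform (int K) (sqrt_power_rational (kfib_discr K)) n"
proof (induction n)
  case 0
  show "2 ^ 0 * int (kfib K 0)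
      = 2 * binomial_transform (int K) (sqrt_power_irrational (kfib_discr K)) 0"
    and "2 ^ 0 * klucas K 0
      = 2 * binomial_transform (int K) (sqrt_power_rational (kfib_discr K)) 0"
    by (simp_all add: klucas_def)
next
  case (Suc n)
  have "2 ^ Suc n * int (kfib K (Suc n)) = 2 ^ n * (2 * int (kfib K (Suc n)))"
    by simp
  also have "\<dots> = 2 ^ n * klucas K n + int K * (2 ^ n * int (kfib K n))"
    unfolding two_kfib_Suc by (simp add: algebra_simps)
  finally show "2 ^ Suc n * int (kfib K (Suc n))
      = 2 * binomial_transform (int K) (sqrt_power_irrational (kfib_discr K)) (Suc n)"
    unfolding Suc.IH by (simp add: binomial_transform_Suc algebra_simps)
  have "2 ^ Suc n * klucas K (Suc n) = 2 ^ n * (2 * klucas K (Suc n))"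
    by simp
  also have "\<dots> = int K * (2 ^ n * klucas K n) + kfib_discr K * (2 ^ n * int (kfib K n))"
    unfolding two_klucas_Suc by (simp add: algebra_simps)
  finally show "2 ^ Suc n * klucas K (Suc n)
      = 2 * binomial_transform (int K) (sqrt_power_rational (kfib_discr K)) (Suc n)"
    unfolding Suc.IH
    by (simp add: binomial_transform_Suc binomial_transform_mult_left algebra_simps)
qed

lemma odd_prime_gt_2:
  fixes p :: nat
  assumes "prime p" "odd p"
  shows "p > 2"
  using assms prime_ge_2_nat[of p] by (cases "p = 2") auto

lemma fermat_power_prime_cong:
  fixes a p :: nat
  assumes "prime p"
  shows "[a ^ p = a] (mod p)"
proof (cases "p dvd a")
  case True
  then have "p dvd a ^ p"
    using prime_gt_0_nat[OF assms] by (metis dvd_power dvd_trans)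
  with True show ?thesis
    by (simp add: cong_def mod_eq_0_iff_dvd)
next
  case False
  have "[a * a ^ (p - 1) = a * 1] (mod p)"
    using fermat_theorem[OF assms False] by (rule cong_scalar_left)
  then show ?thesis
    using prime_gt_0_nat[OF assms] by (simp add: power_eq_if)
qed

lemma cong_mult_two_cancel:
  fixes x y m :: int
  assumes "[2 * x = 2 * y] (mod m)" "odd m"
  shows "[x = y] (mod m)"
  using assms by (simp add: cong_mult_lcancel)

lemma cong_two_power_prime_cancel:
  fixes x y :: int
  assumes "prime p" "odd p" "[2 ^ p * x = 2 * y] (mod int p)"
  shows "[x = y] (mod int p)"
proof -
  have "[2 * x = 2 ^ p * x] (mod int p)"
    using fermat_power_prime_cong[OF assms(1), of 2]
    by (intro cong_scalar_right) (metis cong_int_iff cong_sym of_nat_numeral of_nat_power)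
  then have "[2 * x = 2 * y] (mod int p)"
    using assms(3) by (rule cong_trans)
  then show ?thesis
    by (rule cong_mult_two_cancel) (use assms(2) in simp)
qed

lemma kfib_prime_cong_Legendre:
  assumes "prime p" "odd p"
  shows "[int (kfib K p) = Legendre (kfib_discr K) (int p)] (mod int p)"
proof -
  let ?coeff = "sqrt_power_irrational (kfib_discr K)"
  have "[int (kfib K p) = binomial_transform (int K) ?coeff p] (mod int p)"
    using assms
    by (rule cong_two_power_prime_cancel) (simp only: kfib_klucas_eq_binomial_transform cong_refl)
  also have "[binomial_transform (int K) ?coeff p = int K ^ p * ?coeff 0 + ?coeff p] (mod int p)"
    using assms(1) by (rule binomial_transform_prime_cong)
  also have "int K ^ p * ?coeff 0 + ?coeff p = kfib_discr K ^ ((p - 1) div 2)"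
    using assms(2) by (auto simp: sqrt_power_irrational_def elim!: oddE)
  also have "[kfib_discr K ^ ((p - 1) div 2) = Legendre (kfib_discr K) (int p)] (mod int p)"
    using euler_criterion[OF assms(1) odd_prime_gt_2[OF assms]] by (rule cong_sym)
  finally show ?thesis .
qed

lemma klucas_prime_cong:
  assumes "prime p" "odd p"
  shows "[klucas K p = int K] (mod int p)"
proof -
  let ?coeff = "sqrt_power_rational (kfib_discr K)"
  have "[klucas K p = binomial_transform (int K) ?coeff p] (mod int p)"
    using assms
    by (rule cong_two_power_prime_cancel) (simp only: kfib_klucas_eq_binomial_transform cong_refl)
  also have "[binomial_transform (int K) ?coeff p = int K ^ p * ?coeff 0 + ?coeff p] (mod int p)"
    using assms(1) by (rule binomial_transform_prime_cong)
  also have "int K ^ p * ?coeff 0 + ?coeff p = int K ^ p"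
    using assms(2) by (simp add: sqrt_power_rational_def)
  also have "[int K ^ p = int K] (mod int p)"
    using fermat_power_prime_cong[OF assms(1), of K] by (metis cong_int_iff of_nat_power)
  finally show ?thesis .
qed

lemma two_kfib_Suc_prime_cong:
  assumes "prime p" "odd p" "[int (kfib K p) = u] (mod int p)"
  shows "[2 * int (kfib K (Suc p)) = int K * (1 + u)] (mod int p)"
proof -
  have "[klucas K p + int K * int (kfib K p) = int K + int K * u] (mod int p)"
    using assms by (intro cong_add klucas_prime_cong cong_scalar_left)
  then show ?thesis
    by (simp only: two_kfib_Suc distrib_left mult_1_right)
qed

lemma kpisano_dvd_prime_minus_1:
  assumes "prime p" "odd p" "Legendre (kfib_discr K) (int p) = 1"
  shows "kpisano K p dvd p - 1"
proof -
  obtain r where r: "p = Suc r" "r > 0"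
    using prime_gt_1_nat[OF assms(1)] by (cases p) auto
  have kfib_p: "[int (kfib K p) = 1] (mod int p)"
    using kfib_prime_cong_Legendre[OF assms(1,2), of K] assms(3) by simp
  have "[2 * int (kfib K (Suc p)) = 2 * int K] (mod int p)"
    using two_kfib_Suc_prime_cong[OF assms(1,2) kfib_p] by (simp only: mult.commute one_add_one)
  then have "[int (kfib K (Suc p)) = int K] (mod int p)"
    by (rule cong_mult_two_cancel) (use assms(2) in simp)
  then have "[int (kfib K (Suc p)) - int K * int (kfib K p) = int K - int K * 1] (mod int p)"
    using kfib_p by (intro cong_diff cong_scalar_left)
  moreover have "kfib K (Suc p) = K * kfib K p + kfib K r"
    by (simp add: r)
  ultimately have "p dvd kfib K r"
    by (simp add: cong_0_iff)
  moreover have "[kfib K (Suc r) ^ 1 = 1] (mod p)"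
    using kfib_p by (simp add: r flip: cong_int_iff)
  ultimately show ?thesis
    using kpisano_dvd_mult[of r 1 p K] r by simp
qed

lemma kpisano_dvd_twice_prime_plus_1:
  assumes "prime p" "odd p" "Legendre (kfib_discr K) (int p) = -1"
  shows "kpisano K p dvd 2 * (p + 1)"
proof -
  have kfib_p: "[int (kfib K p) = -1] (mod int p)"
    using kfib_prime_cong_Legendre[OF assms(1,2), of K] assms(3) by simp
  have "[2 * int (kfib K (Suc p)) = 2 * 0] (mod int p)"
    using two_kfib_Suc_prime_cong[OF assms(1,2) kfib_p] by simp
  then have kfib_Suc_p: "[int (kfib K (Suc p)) = 0] (mod int p)"
    by (rule cong_mult_two_cancel) (use assms(2) in simp)
  have "[int K * int (kfib K (Suc p)) + int (kfib K p) = int K * 0 + -1] (mod int p)"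
    using kfib_p kfib_Suc_p by (intro cong_add cong_scalar_left)
  then have "[int (kfib K (Suc (Suc p))) = -1] (mod int p)"
    by simp
  then have "[int (kfib K (Suc (Suc p))) ^ 2 = (-1) ^ 2] (mod int p)"
    by (rule cong_pow)
  then have "[kfib K (Suc (Suc p)) ^ 2 = 1] (mod p)"
    by (simp del: kfib.simps flip: cong_int_iff)
  moreover have "p dvd kfib K (Suc p)"
    using kfib_Suc_p by (simp add: cong_0_iff)
  ultimately show ?thesis
    using kpisano_dvd_mult[of "Suc p" 2 p K] by simp
qed

lemma kpisano_dvd_four_times_prime:
  assumes "prime p" "odd p" "p dvd K\<^sup>2 + 4"
  shows "kpisano K p dvd 4 * p"
proof -
  let ?F = "int (kfib K (Suc p))"
  have "int p dvd kfib_discr K"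
    using assms(3) by (simp only: dvd_kfib_discr_iff)
  then have "Legendre (kfib_discr K) (int p) = 0" and K_square: "[(int K)\<^sup>2 = -4] (mod int p)"
    by (simp_all add: Legendre_def kfib_discr_def cong_0_iff cong_iff_dvd_diff)
  then have kfib_p: "[int (kfib K p) = 0] (mod int p)"
    using kfib_prime_cong_Legendre[OF assms(1,2), of K] by simp
  have "[2 * ?F = int K] (mod int p)"
    using two_kfib_Suc_prime_cong[OF assms(1,2) kfib_p] by simp
  then have "[(2 * ?F)\<^sup>2 = -4] (mod int p)"
    using K_square cong_pow cong_trans by blast
  then have "[2 * (2 * ?F\<^sup>2) = 2 * (2 * (-1))] (mod int p)"
    by (simp add: power_mult_distrib)
  then have "[2 * ?F\<^sup>2 = 2 * (-1)] (mod int p)"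
    by (rule cong_mult_two_cancel) (use assms(2) in simp)
  then have "[?F\<^sup>2 = -1] (mod int p)"
    by (rule cong_mult_two_cancel) (use assms(2) in simp)
  then have "[(?F\<^sup>2)\<^sup>2 = (-1)\<^sup>2] (mod int p)"
    by (rule cong_pow)
  then have "[kfib K (Suc p) ^ 4 = 1] (mod p)"
    by (simp flip: power_mult cong_int_iff)
  moreover have "p dvd kfib K p"
    using kfib_p by (simp add: cong_0_iff)
  ultimately show ?thesis
    using prime_gt_0_nat[OF assms(1)] by (intro kpisano_dvd_mult) auto
qed

lemma kpisano_prime_dvd_cases:
  assumes "prime p" "odd p"
  obtains "kpisano K p dvd p - 1" | "kpisano K p dvd 2 * (p + 1)"
    | "p dvd K\<^sup>2 + 4" "kpisano K p dvd 4 * p"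
proof -
  consider "Legendre (kfib_discr K) (int p) = 1" | "Legendre (kfib_discr K) (int p) = -1"
    | "p dvd K\<^sup>2 + 4"
    unfolding Legendre_def cong_0_iff dvd_kfib_discr_iff by metis
  then show thesis
    using that kpisano_dvd_prime_minus_1 kpisano_dvd_twice_prime_plus_1
      kpisano_dvd_four_times_prime assms by cases blast+
qed

lemma prime_dvd_four_mult_iff:
  fixes q n :: nat
  assumes "prime q"
  shows "q dvd 4 * n \<longleftrightarrow> q = 2 \<or> q dvd n"
proof -
  have "q dvd 2 * 2 * n \<longleftrightarrow> q dvd 2 \<or> q dvd n"
    using assms by (simp only: prime_dvd_mult_iff disj_assoc disj_absorb)
  moreover have "q dvd 2 \<longleftrightarrow> q = 2"
    using primes_dvd_imp_eq[OF assms two_is_prime_nat] by auto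
  ultimately show ?thesis
    by simp
qed

theorem theorem2p11:
  fixes K p q :: nat
  assumes "K \<ge> 1"
    and "prime p" and "odd p"
    and "prime q" and "q dvd kpisano K p"
  shows "q \<le> p \<and> (q = p \<longrightarrow> p dvd K\<^sup>2 + 4)"
proof -
  have "p > 2"
    using assms(2,3) by (rule odd_prime_gt_2)
  from assms(2,3) show ?thesis
  proof (cases rule: kpisano_prime_dvd_cases[where K = K])
    case 1
    then show ?thesis
      using dvd_imp_le[OF dvd_trans[OF assms(5) 1]] \<open>p > 2\<close> by auto
  next
    case 2
    have "2 * (p + 1) = 4 * ((p + 1) div 2)"
      using assms(3) by presburger
    then have "q = 2 \<or> q dvd (p + 1) div 2"
      using dvd_trans[OF assms(5) 2] prime_dvd_four_mult_iff[OF assms(4)] by metis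
    then show ?thesis
      using \<open>p > 2\<close> by (auto dest: dvd_imp_le)
  next
    case 3
    then have "q = 2 \<or> q dvd p"
      using dvd_trans[OF assms(5)] prime_dvd_four_mult_iff[OF assms(4)] by blast
    then show ?thesis
      using 3 \<open>p > 2\<close> by (auto dest: dvd_imp_le)
  qed
qed

end
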